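(* Let $X$ be a finite topological $T_0$-space such that every potential down beat point $x\in X$ has height $1$, and let $n$ be the number of potential down beat points of $X$. Then $S_F(X)=2^n$.
   Context: For a finite topological $T_0$-space $X$ and $x\in X$, $U_x$ is the intersection of all open sets containing $x$. The relation $x\leq y \iff U_x\subseteq U_y$ is a partial order on $X$, so $U_x=\{y: y\le x\}$; open sets are exactly the lower sets. A point $x\in X$ is a down beat point if $U_x\setminus\{x\}$ has a maximum. The height $ht(P)$ of a finite poset $P$ is one less than the maximum number of elements in a chain of $P$, and the height of a point $x\in X$ is $ht(x)=ht(U_x)$. A point $y\in X$ is a potential down beat point of $X$ if there is a sequence $x_1,\dots,x_m\in X$ ($m\ge 1$) such that $x_1$ is a down beat point of $X$, $x_{i+1}$ is a down beat point of the subspace $X\setminus\{x_1,\dots,x_i\}$ for every $i=1,\dots,m-1$, $ht(x_i)\leq ht(x_j)$ (heights taken in $X$) whenever $i\leq j$, and $y=x_m$. $\mathbb{R}_0^+$ is the set of non-negative real numbers with the usual topology. A semiflow on $X$ is a continuous map $\varphi:\mathbb{R}_0^+\times X\to X$ (product topology on the domain) such that $\varphi(0,x)=x$ for all $x\in X$ and $\varphi(s,\varphi(t,x))=\varphi(s+t,x)$ for all $x\in X$, $s,t\in\mathbb{R}_0^+$. $S_F(X)$ denotes the number of distinct semiflows on $X$ (including the trivial one, $\varphi(t,x)=x$). *)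

theory Defs
  imports "HOL-Analysis.Analysis" "HOL-Library.FuncSet"
begin

definition min_open :: "'a topology \<Rightarrow> 'a \<Rightarrow> 'a set" where
  "min_open X x = \<Inter>{U. openin X U \<and> x \<in> U}"

(* Only meaningful for points of topspace X: outside it min_open is UNIV. *)
definition top_le :: "'a topology \<Rightarrow> 'a \<Rightarrow> 'a \<Rightarrow> bool" where
  "top_le X x y \<longleftrightarrow> min_open X x \<subseteq> min_open X y"

definition down_beat_point :: "'a topology \<Rightarrow> 'a \<Rightarrow> bool" where
  "down_beat_point X x \<longleftrightarrow> x \<in> topspace X \<and>
     (\<exists>m \<in> min_open X x - {x}. \<forall>y \<in> min_open X x - {x}. top_le X y m)"

(* Integer-valued, so that the empty poset has height -1 instead of a truncated 0. *)
definition poset_height :: "('a \<Rightarrow> 'a \<Rightarrow> bool) \<Rightarrow> 'a set \<Rightarrow> int" where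
  "poset_height le P =
     int (Max (card ` {C. C \<subseteq> P \<and> Complete_Partial_Order.chain le C})) - 1"

definition point_height :: "'a topology \<Rightarrow> 'a \<Rightarrow> int" where
  "point_height X x = poset_height (top_le X) (min_open X x)"

(* The list xs is the sequence x_1, ..., x_m with indices shifted to start at 0;
   set (take i xs) are the points removed before step i. Heights are taken in X throughout. *)
definition potential_down_beat_point :: "'a topology \<Rightarrow> 'a \<Rightarrow> bool" where
  "potential_down_beat_point X y \<longleftrightarrow>
     (\<exists>xs. xs \<noteq> [] \<and> set xs \<subseteq> topspace X \<and>
       (\<forall>i < length xs.
          down_beat_point (subtopology X (topspace X - set (take i xs))) (xs ! i)) \<and>
       (\<forall>i j. i \<le> j \<and> j < length xs \<longrightarrow>
          point_height X (xs ! i) \<le> point_height X (xs ! j)) \<and>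
       y = last xs)"

definition semiflow :: "'a topology \<Rightarrow> (real \<times> 'a \<Rightarrow> 'a) \<Rightarrow> bool" where
  "semiflow X \<phi> \<longleftrightarrow>
     continuous_map (prod_topology (top_of_set {0..}) X) X \<phi> \<and>
     (\<forall>x \<in> topspace X. \<phi> (0, x) = x) \<and>
     (\<forall>x \<in> topspace X. \<forall>s \<ge> 0. \<forall>t \<ge> 0. \<phi> (s, \<phi> (t, x)) = \<phi> (s + t, x))"

(* Semiflows are functions on [0, infinity) x X only, so we count representatives that are
   extensional outside this domain. *)
definition num_semiflows :: "'a topology \<Rightarrow> nat" where
  "num_semiflows X = card {\<phi> \<in> extensional ({0..} \<times> topspace X). semiflow X \<phi>}"

end

theory Submission
  imports Defs
begin

text \<open>For every point the orbit of a semiflow is decreasing in the specialization order, because this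
  holds for small times; since the space is finite, the semigroup law makes the orbit constant on
  positive times. So a semiflow is given by a single order preserving idempotent map below the
  identity. The points moved by such a map, listed by increasing height, form a sequence
  of potential down beat points. If these all have height 1, the minimal open set of each
  of them consists of the point and one minimal point, so the map is determined by the set of points
  it moves, and every set of potential down beat points occurs.\<close>

section \<open>Minimal open sets and beat points of subspaces\<close>

lemma min_open_refl: "x \<in> min_open X x"
  by (auto simp: min_open_def)

lemma min_open_least: "openin X U \<Longrightarrow> x \<in> U \<Longrightarrow> min_open X x \<subseteq> U"
  by (auto simp: min_open_def)

lemma min_open_subset_topspace: "x \<in> topspace X \<Longrightarrow> min_open X x \<subseteq> topspace X"
  by (simp add: min_open_least)

lemma openin_min_open:
  assumes "finite (topspace X)" "x \<in> topspace X"
  shows "openin X (min_open X x)"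
  unfolding min_open_def
proof (rule openin_Inter)
  have "{U. openin X U \<and> x \<in> U} \<subseteq> Pow (topspace X)"
    using openin_subset by blast
  then show "finite {U. openin X U \<and> x \<in> U}"
    using assms(1) finite_subset by blast
  show "{U. openin X U \<and> x \<in> U} \<noteq> {}"
    using assms(2) by blast
qed auto

lemma top_le_iff_mem_min_open:
  assumes "finite (topspace X)" "y \<in> topspace X"
  shows "top_le X x y \<longleftrightarrow> x \<in> min_open X y"
  unfolding top_le_def
  using min_open_refl min_open_least[OF openin_min_open[OF assms]] by fast

lemma min_open_subtopology:
  assumes "A \<subseteq> topspace X" "x \<in> A"
  shows "min_open (subtopology X A) x = min_open X x \<inter> A"
proof -
  have "{U. openin (subtopology X A) U \<and> x \<in> U} = (\<lambda>T. T \<inter> A) ` {T. openin X T \<and> x \<in> T}"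
    using assms(2) by (auto simp: openin_subtopology)
  moreover have "topspace X \<in> {T. openin X T \<and> x \<in> T}"
    using assms by auto
  ultimately show ?thesis
    unfolding min_open_def by auto
qed

text \<open>Minimal open sets of a subspace are traces of those of \<open>X\<close>, so beat points
  after a removal can be tested with the order of \<open>X\<close>.\<close>

lemma down_beat_point_subtopology_iff:
  assumes "finite (topspace X)" "A \<subseteq> topspace X" "x \<in> A"
  shows "down_beat_point (subtopology X A) x \<longleftrightarrow>
    (\<exists>m \<in> min_open X x \<inter> A - {x}. min_open X x \<inter> A - {x} \<subseteq> min_open X m)"
proof -
  have top: "topspace (subtopology X A) = A"
    using assms(2) by auto
  have "finite A"
    using assms(1,2) finite_subset by blast
  then have "top_le (subtopology X A) y m \<longleftrightarrow> y \<in> min_open X m"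
    if "m \<in> A" "y \<in> A" for y m
    using that assms(2) top_le_iff_mem_min_open[of "subtopology X A" m y]
    by (simp add: top subset_iff min_open_subtopology[OF assms(2)])
  then show ?thesis
    using assms(3) unfolding down_beat_point_def top min_open_subtopology[OF assms(2,3)] by blast
qed

text \<open>The conditions on an entry involve only that entry and earlier ones, so cutting the list
  after entry \<open>k\<close> leaves a valid sequence that ends there.\<close>

lemma potential_down_beat_point_nth:
  assumes xs: "set xs \<subseteq> topspace X"
    and beat: "\<And>i. i < length xs \<Longrightarrow>
      down_beat_point (subtopology X (topspace X - set (take i xs))) (xs ! i)"
    and mono: "\<And>i j. i \<le> j \<Longrightarrow> j < length xs \<Longrightarrow>
      point_height X (xs ! i) \<le> point_height X (xs ! j)"
    and k: "k < length xs"
  shows "potential_down_beat_point X (xs ! k)"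
  unfolding potential_down_beat_point_def
proof (intro exI[of _ "take (Suc k) xs"] conjI allI impI)
  show "take (Suc k) xs \<noteq> []"
    using k by auto
  show "set (take (Suc k) xs) \<subseteq> topspace X"
    using xs set_take_subset[of "Suc k" xs] by blast
  show "xs ! k = last (take (Suc k) xs)"
    using k by (simp add: take_Suc_conv_app_nth)
  fix i
  assume "i < length (take (Suc k) xs)"
  then have "i < Suc k" "i < length xs"
    by auto
  then show "down_beat_point (subtopology X (topspace X - set (take i (take (Suc k) xs))))
      (take (Suc k) xs ! i)"
    using beat[of i] by (simp add: min_absorb1)
next
  fix i j
  assume "i \<le> j \<and> j < length (take (Suc k) xs)"
  then show "point_height X (take (Suc k) xs ! i) \<le> point_height X (take (Suc k) xs ! j)"
    using mono[of i j] by simp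
qed

section \<open>Order, heights and potential down beat points\<close>

locale finite_t0_space =
  fixes X :: "'a topology"
  assumes finite_topspace: "finite (topspace X)"
    and t0: "t0_space X"
begin

lemma min_open_mono:
  assumes "x \<in> topspace X" "y \<in> min_open X x"
  shows "min_open X y \<subseteq> min_open X x"
  using assms openin_min_open[OF finite_topspace] min_open_least by metis

text \<open>The T_0 axiom enters here: an open set separating the two points would contain the
  minimal open set of one of them, hence also the other point.\<close>

lemma min_open_antisym:
  assumes "x \<in> topspace X" "y \<in> min_open X x" "x \<in> min_open X y"
  shows "x = y"
proof (rule ccontr)
  assume "x \<noteq> y"
  moreover have "y \<in> topspace X"
    using assms(2) min_open_subset_topspace[OF assms(1)] by blast
  ultimately obtain U where "openin X U" "x \<notin> U \<longleftrightarrow> y \<in> U"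
    using t0 assms(1) unfolding t0_space_def by metis
  then show False
    using assms(2,3) min_open_least[of X U] by blast
qed

lemma openin_if_min_open_subset:
  assumes "V \<subseteq> topspace X" "\<And>x. x \<in> V \<Longrightarrow> min_open X x \<subseteq> V"
  shows "openin X V"
proof (subst openin_subopen, intro ballI exI conjI)
  fix x
  assume "x \<in> V"
  with assms show "openin X (min_open X x)" "x \<in> min_open X x" "min_open X x \<subseteq> V"
    using openin_min_open[OF finite_topspace] min_open_refl by auto
qed

text \<open>Finiteness gives the \<open>Max\<close> in \<open>poset_height\<close> its
  meaning.\<close>

lemma finite_chain_cards:
  assumes "x \<in> topspace X"
  shows "finite (card ` {C. C \<subseteq> min_open X x \<and> Complete_Partial_Order.chain (top_le X) C})"
proof (intro finite_imageI)
  have "finite (min_open X x)"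
    using finite_subset[OF min_open_subset_topspace[OF assms] finite_topspace] .
  then show "finite {C. C \<subseteq> min_open X x \<and> Complete_Partial_Order.chain (top_le X) C}"
    by simp
qed

lemma card_chain_le_point_height:
  assumes "x \<in> topspace X" "C \<subseteq> min_open X x" "Complete_Partial_Order.chain (top_le X) C"
  shows "int (card C) - 1 \<le> point_height X x"
  unfolding point_height_def poset_height_def
  using Max_ge[OF finite_chain_cards[OF assms(1)], of "card C"] assms(2,3) by simp

lemma point_height_nonneg:
  assumes "x \<in> topspace X"
  shows "point_height X x \<ge> 0"
  using card_chain_le_point_height[OF assms, of "{x}"]
  by (simp add: chain_def min_open_refl top_le_def)

lemma point_height_attained:
  assumes "x \<in> topspace X"
  obtains C where "C \<subseteq> min_open X x" "Complete_Partial_Order.chain (top_le X) C"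
    "point_height X x = int (card C) - 1"
proof -
  let ?K = "{C. C \<subseteq> min_open X x \<and> Complete_Partial_Order.chain (top_le X) C}"
  \<comment> \<open>The empty chain makes the set of cardinalities nonempty, as
    \<open>Max_in\<close> requires.\<close>
  have "{} \<in> ?K"
    by (simp add: chain_def)
  then have "Max (card ` ?K) \<in> card ` ?K"
    using finite_chain_cards[OF assms] by (intro Max_in) auto
  then obtain C where "C \<in> ?K" "Max (card ` ?K) = card C"
    by blast
  then show thesis
    using that[of C] by (simp add: point_height_def poset_height_def)
qed

text \<open>A longest chain below \<open>y\<close> grows by adding \<open>x\<close>, which by
  antisymmetry is not in it.\<close>

lemma point_height_less:
  assumes x: "x \<in> topspace X" and y: "y \<in> min_open X x" "y \<noteq> x"
  shows "point_height X y < point_height X x"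
proof -
  have "y \<in> topspace X"
    using y(1) min_open_subset_topspace[OF x] by blast
  then obtain C where C: "C \<subseteq> min_open X y" "Complete_Partial_Order.chain (top_le X) C"
      "point_height X y = int (card C) - 1"
    using point_height_attained by metis
  have sub: "C \<subseteq> min_open X x"
    using C(1) min_open_mono[OF x y(1)] by blast
  then have "finite C"
    using min_open_subset_topspace[OF x] finite_topspace by (meson finite_subset)
  moreover have "x \<notin> C"
    using C(1) min_open_antisym[OF x y(1)] y(2) by auto
  ultimately have "card (insert x C) = Suc (card C)"
    by simp
  moreover have "Complete_Partial_Order.chain (top_le X) (insert x C)"
    using C(2) sub min_open_refl[of x X] top_le_iff_mem_min_open[OF finite_topspace x]
    unfolding chain_def by auto
  then have "int (card (insert x C)) - 1 \<le> point_height X x"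
    using sub min_open_refl[of x X] by (intro card_chain_le_point_height[OF x]) auto
  ultimately show ?thesis
    using C(3) by linarith
qed

text \<open>Remove the moved points in order of height. When the turn of \<open>z\<close> comes,
  every remaining point strictly below \<open>z\<close> is fixed by \<open>r\<close>, so
  monotonicity puts it below \<open>r z\<close>; thus \<open>r z\<close> is the required
  maximum.\<close>

lemma potential_down_beat_point_if_moved:
  assumes r_top: "\<And>x. x \<in> topspace X \<Longrightarrow> r x \<in> min_open X x"
    and r_mono: "\<And>x y. x \<in> topspace X \<Longrightarrow> y \<in> min_open X x \<Longrightarrow> r y \<in> min_open X (r x)"
    and r_idem: "\<And>x. x \<in> topspace X \<Longrightarrow> r (r x) = r x"
    and y: "y \<in> topspace X" "r y \<noteq> y"
  shows "potential_down_beat_point X y"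
proof -
  define S where "S = {x \<in> topspace X. r x \<noteq> x}"
  obtain xs where xs: "set xs = S" "sorted (map (point_height X) xs)" "distinct xs"
  proof -
    obtain ys where "set ys = S" "distinct ys"
      using finite_distinct_list[of S] finite_topspace by (auto simp: S_def)
    then show thesis
      using that[of "sort_key (point_height X) ys"] by simp
  qed
  have "y \<in> set xs"
    using xs(1) y by (simp add: S_def)
  then obtain k where k: "k < length xs" "xs ! k = y"
    by (auto simp: in_set_conv_nth)
  have mono: "point_height X (xs ! i) \<le> point_height X (xs ! j)" if "i \<le> j" "j < length xs" for i j
    using sorted_nth_mono[OF xs(2), of i j] that by simp
  have beat: "down_beat_point (subtopology X (topspace X - set (take i xs))) (xs ! i)"
    if i: "i < length xs" for i
  proof -
    define A where "A = topspace X - set (take i xs)"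
    have z: "xs ! i \<in> topspace X" "r (xs ! i) \<noteq> xs ! i"
      using i xs(1) nth_mem unfolding S_def by blast+
    have zA: "xs ! i \<in> A"
      using xs(3) i z(1) by (auto simp: A_def in_set_conv_nth nth_eq_iff_index_eq)
    \<comment> \<open>A moved \<open>w\<close> strictly below has smaller height, so it stands
      earlier in the sorted list and has been removed.\<close>
    have fixed: "r w = w" if w: "w \<in> min_open X (xs ! i) \<inter> A - {xs ! i}" for w
    proof (rule ccontr)
      assume "r w \<noteq> w"
      then have "w \<in> set xs"
        using w xs(1) by (auto simp: S_def A_def)
      then obtain j where j: "j < length xs" "xs ! j = w"
        by (auto simp: in_set_conv_nth)
      have "point_height X w < point_height X (xs ! i)"
        using w by (intro point_height_less[OF z(1)]) auto
      then have "j < i"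
        using mono[of i j] j by fastforce
      then have "w \<in> set (take i xs)"
        using j i by (auto simp: in_set_conv_nth)
      then show False
        using w by (simp add: A_def)
    qed
    \<comment> \<open>Idempotence keeps \<open>r (xs ! i)\<close> out of \<open>S\<close>, so it has
      not been removed.\<close>
    have r_z: "r (xs ! i) \<in> min_open X (xs ! i) \<inter> A - {xs ! i}"
    proof -
      have "r (xs ! i) \<notin> S"
        using r_idem[OF z(1)] by (simp add: S_def)
      then have "r (xs ! i) \<notin> set (take i xs)"
        using xs(1) set_take_subset[of i xs] by blast
      then show ?thesis
        using r_top[OF z(1)] z min_open_subset_topspace[OF z(1)] by (auto simp: A_def)
    qed
    moreover have "min_open X (xs ! i) \<inter> A - {xs ! i} \<subseteq> min_open X (r (xs ! i))"
      using fixed r_mono[OF z(1)] by fastforce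
    ultimately show ?thesis
      using zA unfolding A_def[symmetric]
      by (subst down_beat_point_subtopology_iff[OF finite_topspace]) (auto simp: A_def)
  qed
  have "set xs \<subseteq> topspace X"
    using xs(1) by (auto simp: S_def)
  then show ?thesis
    using potential_down_beat_point_nth[OF _ beat mono k(1)] k(2) by simp
qed

text \<open>Removed points are themselves potential down beat points, of height 1, whereas points
  strictly below \<open>x\<close> have height 0. So none of the latter was removed, and the maximum
  \<open>m\<close> bounds them all; a second one would lie strictly below \<open>m\<close> and have
  negative height.\<close>

lemma min_open_potential_down_beat_point:
  assumes height: "\<And>x. potential_down_beat_point X x \<Longrightarrow> point_height X x = 1"
    and x: "potential_down_beat_point X x"
  obtains m where "m \<noteq> x" "min_open X x = {x, m}"
proof -
  obtain xs where xs: "xs \<noteq> []" "set xs \<subseteq> topspace X" "x = last xs"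
    and beat: "\<And>i. i < length xs \<Longrightarrow>
      down_beat_point (subtopology X (topspace X - set (take i xs))) (xs ! i)"
    and mono: "\<And>i j. i \<le> j \<Longrightarrow> j < length xs \<Longrightarrow>
      point_height X (xs ! i) \<le> point_height X (xs ! j)"
    using x unfolding potential_down_beat_point_def by blast
  define k where "k = length xs - 1"
  have k: "k < length xs" "xs ! k = x"
    using xs by (auto simp: k_def last_conv_nth)
  have potential: "potential_down_beat_point X (xs ! i)" if "i < length xs" for i
    using potential_down_beat_point_nth[OF xs(2) beat mono that] .
  define A where "A = topspace X - set (take k xs)"
  have x_top: "x \<in> topspace X"
    using xs by auto
  have down: "down_beat_point (subtopology X A) x"
    using beat[OF k(1)] k(2) by (simp add: A_def)
  then have "x \<in> A"
    by (simp add: down_beat_point_def)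
  then obtain m where m: "m \<in> min_open X x \<inter> A - {x}"
      "min_open X x \<inter> A - {x} \<subseteq> min_open X m"
    using down down_beat_point_subtopology_iff[OF finite_topspace, of A x] by (auto simp: A_def)
  have less: "point_height X y < 1" if "y \<in> min_open X x" "y \<noteq> x" for y
    using point_height_less[OF x_top that] height[OF x] by simp
  have "y \<in> A" if y: "y \<in> min_open X x" "y \<noteq> x" for y
  proof (rule ccontr)
    assume "y \<notin> A"
    then have "y \<in> set (take k xs)"
      using y(1) min_open_subset_topspace[OF x_top] by (auto simp: A_def)
    then have "y \<in> set xs"
      by (rule in_set_takeD)
    then have "potential_down_beat_point X y"
      using potential by (auto simp: in_set_conv_nth)
    then show False
      using less[OF y] height by fastforce
  qed
  then have sub: "min_open X x - {x} \<subseteq> min_open X m"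
    using m(2) by blast
  have m_top: "m \<in> topspace X"
    using m(1) by (auto simp: A_def)
  have "y = m" if y: "y \<in> min_open X x" "y \<noteq> x" for y
  proof (rule ccontr)
    assume "y \<noteq> m"
    then have "point_height X y < point_height X m"
      using sub y by (intro point_height_less[OF m_top]) auto
    then show False
      using point_height_nonneg[of y] less[of m] m(1) y(1) min_open_subset_topspace[OF x_top] by auto
  qed
  then have "min_open X x = {x, m}"
    using m(1) min_open_refl[of x X] by auto
  then show thesis
    using that[of m] m(1) by auto
qed

end

section \<open>Orbits of a semiflow\<close>

locale semiflow_on_finite_t0_space = finite_t0_space X for X :: "'a topology" +
  fixes \<phi> :: "real \<times> 'a \<Rightarrow> 'a"
  assumes semiflow: "semiflow X \<phi>"
begin

lemma flow_0: "x \<in> topspace X \<Longrightarrow> \<phi> (0, x) = x"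
  using semiflow by (simp add: semiflow_def)

lemma flow_add: "x \<in> topspace X \<Longrightarrow> s \<ge> 0 \<Longrightarrow> t \<ge> 0 \<Longrightarrow> \<phi> (s + t, x) = \<phi> (s, \<phi> (t, x))"
  using semiflow by (simp add: semiflow_def)

lemma flow_cont: "continuous_map (prod_topology (top_of_set {0..}) X) X \<phi>"
  using semiflow by (simp add: semiflow_def)

lemma flow_in_topspace: "x \<in> topspace X \<Longrightarrow> t \<ge> 0 \<Longrightarrow> \<phi> (t, x) \<in> topspace X"
  using continuous_map_image_subset_topspace[OF flow_cont] by auto

text \<open>Continuity at \<open>(t, x)\<close> is tested on the smallest neighbourhood of the
  image. The space factor of an open box around \<open>(t, x)\<close> contains
  \<open>min_open X x\<close>, so one \<open>V\<close> serves all \<open>y\<close> there.\<close>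

lemma flow_locally_bounded:
  assumes x: "x \<in> topspace X" and t: "t \<ge> 0"
  obtains V where "openin (top_of_set {0..}) V" "t \<in> V"
    "\<And>s y. s \<in> V \<Longrightarrow> y \<in> min_open X x \<Longrightarrow> \<phi> (s, y) \<in> min_open X (\<phi> (t, x))"
proof -
  let ?P = "prod_topology (top_of_set {0::real..}) X"
  let ?W = "{z \<in> topspace ?P. \<phi> z \<in> min_open X (\<phi> (t, x))}"
  have W: "openin ?P ?W"
    using flow_cont openin_min_open[OF finite_topspace flow_in_topspace[OF x t]]
    by (rule openin_continuous_map_preimage)
  have "(t, x) \<in> ?W"
    using x t by (simp add: min_open_refl)
  from iffD1[OF openin_prod_topology_alt W, rule_format, OF this] obtain V V' where V: "openin (top_of_set {0..}) V" "openin X V'"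
      "t \<in> V" "x \<in> V'" "V \<times> V' \<subseteq> ?W"
    by (elim exE conjE)
  show thesis
  proof
    show "\<phi> (s, y) \<in> min_open X (\<phi> (t, x))" if "s \<in> V" "y \<in> min_open X x" for s y
      using that V(5) min_open_least[OF V(2,4)] by auto
  qed (use V in auto)
qed

lemma flow_mono:
  assumes "x \<in> topspace X" "y \<in> min_open X x" "t \<ge> 0"
  shows "\<phi> (t, y) \<in> min_open X (\<phi> (t, x))"
  using flow_locally_bounded[OF assms(1,3)] assms(2) by metis

text \<open>Sufficiently short times move every point downwards, and any time is a sum of equally
  many short steps as needed, each of which descends.\<close>

lemma flow_le:
  assumes x: "x \<in> topspace X" and t: "t \<ge> 0"
  shows "\<phi> (t, x) \<in> min_open X x"
proof -
  have "\<forall>\<^sub>F t in at_right 0. \<phi> (t, x) \<in> min_open X x" if x: "x \<in> topspace X" for x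
  proof -
    obtain V where V: "openin (top_of_set {0..}) V" "0 \<in> V"
        "\<And>s. s \<in> V \<Longrightarrow> \<phi> (s, x) \<in> min_open X x"
      using flow_locally_bounded[OF x order_refl] flow_0[OF x] min_open_refl by metis
    then obtain e where e: "e > 0" "ball 0 e \<inter> {0..} \<subseteq> V"
      unfolding openin_contains_ball by blast
    have "s \<in> V" if "0 < s" "s < e" for s
      using e(2) that by (auto simp: dist_real_def)
    then show ?thesis
      using V(3) e(1) unfolding eventually_at_right_field by blast
  qed
  \<comment> \<open>Finiteness yields one bound \<open>e\<close> for all points, so the same step
    length works at every point the orbit visits.\<close>
  then have "\<forall>\<^sub>F t in at_right 0. \<forall>x \<in> topspace X. \<phi> (t, x) \<in> min_open X x"
    by (intro eventually_ball_finite finite_topspace) blast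
  then obtain e where e: "e > 0"
      "\<And>t x. 0 < t \<Longrightarrow> t < e \<Longrightarrow> x \<in> topspace X \<Longrightarrow> \<phi> (t, x) \<in> min_open X x"
    unfolding eventually_at_right_field by auto
  have steps: "\<phi> (real k * d, x) \<in> min_open X x" if d: "0 < d" "d < e" for k d
  proof (induction k)
    case 0
    then show ?case
      using flow_0[OF x] min_open_refl by simp
  next
    case (Suc k)
    have "\<phi> (real k * d, x) \<in> topspace X"
      using flow_in_topspace[OF x] d by simp
    then have "\<phi> (d, \<phi> (real k * d, x)) \<in> min_open X (\<phi> (real k * d, x))"
      using e(2) d by blast
    then have "\<phi> (d + real k * d, x) \<in> min_open X x"
      using flow_add[OF x, of d "real k * d"] d min_open_mono[OF x Suc.IH] by auto
    then show ?case
      by (simp add: algebra_simps)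
  qed
  show ?thesis
  proof (cases "t = 0")
    case True
    then show ?thesis
      using flow_0[OF x] min_open_refl by simp
  next
    case False
    \<comment> \<open>This choice makes each of the \<open>k\<close> equal steps
      \<open>t / real k\<close> shorter than \<open>e\<close>.\<close>
    obtain k :: nat where k: "t / e < real k"
      using reals_Archimedean2 by blast
    moreover have "t / e > 0"
      using False t e(1) by simp
    ultimately have "real k > 0"
      by linarith
    then have "0 < t / real k" "t / real k < e" "real k * (t / real k) = t"
      using k False t e(1) by (auto simp: field_simps)
    then show ?thesis
      using steps by metis
  qed
qed

lemma flow_decreasing:
  assumes "x \<in> topspace X" "0 \<le> s" "s \<le> t"
  shows "\<phi> (t, x) \<in> min_open X (\<phi> (s, x))"
  using flow_le[OF flow_in_topspace[OF assms(1,2)], of "t - s"]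
    flow_add[OF assms(1), of "t - s" s] assms by simp

text \<open>By the pigeonhole principle two times in \<open>{0<..<s}\<close> carry the orbit to the same point, so the
  orbit is periodic from \<open>s\<close> on; being decreasing, it is constant.\<close>

lemma flow_const_aux:
  assumes x: "x \<in> topspace X" and s: "0 < s" "s \<le> t"
  shows "\<phi> (t, x) = \<phi> (s, x)"
proof -
  have "\<not> inj_on (\<lambda>u. \<phi> (u, x)) {0<..<s}"
  proof
    assume "inj_on (\<lambda>u. \<phi> (u, x)) {0<..<s}"
    moreover have "(\<lambda>u. \<phi> (u, x)) ` {0<..<s} \<subseteq> topspace X"
      using flow_in_topspace[OF x] by auto
    ultimately have "finite {0<..<s}"
      using finite_topspace by (meson inj_on_finite)
    then show False
      using s(1) by (simp add: infinite_Ioo)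
  qed
  then obtain a b where ab: "0 < a" "a < b" "b < s" "\<phi> (a, x) = \<phi> (b, x)"
    unfolding inj_on_def by (metis greaterThanLessThan_iff linorder_neq_iff)
  define d where "d = b - a"
  \<comment> \<open>As \<open>a < s \<le> u\<close>, the orbit can be run for the nonnegative time
    \<open>u - a\<close> from the common point at times \<open>a\<close> and
    \<open>b\<close>.\<close>
  have period: "\<phi> (u + d, x) = \<phi> (u, x)" if "s \<le> u" for u
    using flow_add[OF x, of "u - a" a] flow_add[OF x, of "u - a" b] ab that
    by (simp add: d_def algebra_simps)
  have periods: "\<phi> (s + real k * d, x) = \<phi> (s, x)" for k
  proof (induction k)
    case (Suc k)
    have "s \<le> s + real k * d"
      using ab by (simp add: d_def)
    from period[OF this] Suc.IH show ?case
      by (simp add: algebra_simps)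
  qed simp
  \<comment> \<open>After \<open>k\<close> periods the time is past \<open>t\<close> and the orbit
    is back at its position at time \<open>s\<close>, which is therefore also below its position at
    time \<open>t\<close>.\<close>
  obtain k :: nat where "(t - s) / d < real k"
    using reals_Archimedean2 by blast
  then have "t \<le> s + real k * d"
    using ab by (simp add: d_def field_simps)
  then have "\<phi> (s, x) \<in> min_open X (\<phi> (t, x))"
    using flow_decreasing[OF x, of t "s + real k * d"] periods[of k] s by simp
  moreover have "\<phi> (t, x) \<in> min_open X (\<phi> (s, x))"
    using flow_decreasing[OF x] s by simp
  ultimately show ?thesis
    using min_open_antisym flow_in_topspace[OF x, of t] s by simp
qed

text \<open>Time 0 is excluded because a point may jump immediately after it.\<close>

lemma flow_const:
  assumes "x \<in> topspace X" "0 < s" "0 < t"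
  shows "\<phi> (s, x) = \<phi> (t, x)"
  using flow_const_aux[OF assms(1)] assms(2,3) by (metis linear)

text \<open>The time-one map is a decreasing monotone map, and it is idempotent because the orbit
  agrees at the positive times 2 and 1.\<close>

lemma potential_down_beat_point_if_flow_moves:
  assumes "x \<in> topspace X" "\<phi> (1, x) \<noteq> x"
  shows "potential_down_beat_point X x"
proof (rule potential_down_beat_point_if_moved[where r = "\<lambda>x. \<phi> (1, x)"])
  show "\<phi> (1, \<phi> (1, x)) = \<phi> (1, x)" if "x \<in> topspace X" for x
    using flow_add[OF that, of 1 1] flow_const[OF that, of 2 1] by simp
qed (use assms flow_le flow_mono in auto)

end

section \<open>Semiflows that jump at once\<close>

context finite_t0_space
begin

text \<open>In its use, \<open>m x\<close> is the only point strictly below \<open>x\<close>.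
  \<open>restrict\<close> selects the extensional representative, the kind counted by
  \<open>num_semiflows\<close>.\<close>

definition jump_flow :: "('a \<Rightarrow> 'a) \<Rightarrow> 'a set \<Rightarrow> real \<times> 'a \<Rightarrow> 'a" where
  "jump_flow m S =
     restrict (\<lambda>(t, x). if t = 0 \<or> x \<notin> S then x else m x) ({0..} \<times> topspace X)"

text \<open>The map \<open>r\<close> that performs the jump is monotone, idempotent and below the
  identity. The last property makes the jump at time 0 continuous: open sets are lower sets, so a
  point of \<open>U\<close> stays in \<open>U\<close>.\<close>

lemma semiflow_jump_flow:
  assumes S: "S \<subseteq> topspace X"
    and m: "\<And>x. x \<in> S \<Longrightarrow> m x \<noteq> x \<and> min_open X x = {x, m x}"
  shows "semiflow X (jump_flow m S)"
proof -
  define r where "r x = (if x \<in> S then m x else x)" for x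
  have flow: "jump_flow m S (t, x) = (if t = 0 then x else r x)" if "t \<ge> 0" "x \<in> topspace X" for t x
    using that by (simp add: jump_flow_def r_def)
  have r_le: "r x \<in> min_open X x" for x
    using m[of x] min_open_refl[of x X] by (auto simp: r_def)
  have r_top: "r x \<in> topspace X" if "x \<in> topspace X" for x
    using r_le[of x] min_open_subset_topspace[OF that] by blast
  have minimal: "min_open X (m x) = {m x}" if "x \<in> S" for x
  proof -
    have x: "x \<in> topspace X" "m x \<in> min_open X x"
      using that S m by auto
    then have "x \<notin> min_open X (m x)"
      using min_open_antisym m[OF that] by metis
    then show ?thesis
      using min_open_mono[OF x] m[OF that] min_open_refl[of "m x" X] by auto
  qed
  \<comment> \<open>If \<open>m x\<close> were in \<open>S\<close>, its minimal open set would have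
    two elements.\<close>
  have not_mem: "m x \<notin> S" if "x \<in> S" for x
    using minimal[OF that] m[of "m x"] by auto
  have r_idem: "r (r x) = r x" for x
    using not_mem by (simp add: r_def)
  have r_mono: "r y \<in> min_open X (r x)" if "x \<in> topspace X" "y \<in> min_open X x" for x y
  proof (cases "x \<in> S")
    case True
    then show ?thesis
      using that(2) m[OF True] not_mem[OF True] min_open_refl by (auto simp: r_def)
  next
    case False
    then show ?thesis
      using r_le[of y] min_open_mono[OF that] by (auto simp: r_def)
  qed
  have "continuous_map (prod_topology (top_of_set {0..}) X) X (jump_flow m S)"
    unfolding continuous_map
  proof (intro conjI allI impI)
    show "jump_flow m S ` topspace (prod_topology (top_of_set {0..}) X) \<subseteq> topspace X"
      using flow r_top by auto
    fix U
    assume U: "openin X U"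
    have U_top: "x \<in> topspace X" if "x \<in> U" for x
      using that openin_subset[OF U] by blast
    have r_U: "r x \<in> U" if "x \<in> U" for x
      using r_le[of x] min_open_least[OF U that] by blast
    have open_r: "openin X {x \<in> topspace X. r x \<in> U}"
    proof (rule openin_if_min_open_subset)
      fix x
      assume "x \<in> {x \<in> topspace X. r x \<in> U}"
      then show "min_open X x \<subseteq> {x \<in> topspace X. r x \<in> U}"
        using r_mono[of x] min_open_subset_topspace[of x X] min_open_least[OF U, of "r x"] by auto
    qed auto
    have "openin (top_of_set {0..}) {0::real<..}"
      by (rule open_subset) auto
    then have "openin (prod_topology (top_of_set {0..}) X)
        ({0::real..} \<times> U \<union> {0<..} \<times> {x \<in> topspace X. r x \<in> U})"
      using U open_r by (intro openin_Un) (auto simp: openin_prod_Times_iff)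
    \<comment> \<open>At positive times the condition is \<open>r x \<in> U\<close>, at time 0 it is
      \<open>x \<in> U\<close>. Since the latter implies the former, the first box can be extended
      to all times and so is open.\<close>
    also have "{0::real..} \<times> U \<union> {0<..} \<times> {x \<in> topspace X. r x \<in> U} =
        {z \<in> topspace (prod_topology (top_of_set {0..}) X). jump_flow m S z \<in> U}"
      using U_top r_U by (auto simp: flow split: if_splits)
    finally show "openin (prod_topology (top_of_set {0..}) X)
        {z \<in> topspace (prod_topology (top_of_set {0..}) X). jump_flow m S z \<in> U}" .
  qed
  \<comment> \<open>For the semigroup law, \<open>s + t\<close> vanishes only if both times do; if
    both are positive, idempotence of \<open>r\<close> applies.\<close>
  then show ?thesis
    unfolding semiflow_def using flow r_top r_idem by (auto simp: add_nonneg_eq_0_iff)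
qed

end

section \<open>Counting semiflows by the sets of points they move\<close>

theorem proposition4p8:
  fixes X :: "'a topology" and n :: nat
  assumes "finite (topspace X)" and "t0_space X"
    and "\<And>x. potential_down_beat_point X x \<Longrightarrow> point_height X x = 1"
    and "n = card {x. potential_down_beat_point X x}"
  shows "num_semiflows X = 2 ^ n"
proof -
  interpret finite_t0_space X
    using assms(1,2) by unfold_locales
  define P where "P = {x. potential_down_beat_point X x}"
  have P_top: "P \<subseteq> topspace X"
    unfolding P_def potential_down_beat_point_def using last_in_set by blast
  have "\<forall>x \<in> P. \<exists>m. m \<noteq> x \<and> min_open X x = {x, m}"
    using min_open_potential_down_beat_point[OF assms(3)] unfolding P_def by blast
  then obtain m where m: "\<And>x. x \<in> P \<Longrightarrow> m x \<noteq> x \<and> min_open X x = {x, m x}"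
    by metis
  have "bij_betw (jump_flow m) (Pow P)
      {\<phi> \<in> extensional ({0..} \<times> topspace X). semiflow X \<phi>}"
  proof (rule bij_betwI')
    fix S S'
    assume "S \<in> Pow P" "S' \<in> Pow P"
    \<comment> \<open>The set is recovered from its semiflow as the points moved at time 1, which
      gives injectivity.\<close>
    moreover have "S = {x \<in> topspace X. jump_flow m S (1, x) \<noteq> x}" if "S \<in> Pow P" for S
      using that m P_top by (auto simp: jump_flow_def)
    ultimately show "jump_flow m S = jump_flow m S' \<longleftrightarrow> S = S'"
      by metis
  next
    fix S
    assume "S \<in> Pow P"
    then have "semiflow X (jump_flow m S)"
      using P_top m by (intro semiflow_jump_flow) auto
    then show "jump_flow m S \<in> {\<phi> \<in> extensional ({0..} \<times> topspace X). semiflow X \<phi>}"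
      by (simp add: jump_flow_def)
  next
    fix \<phi>
    assume \<phi>: "\<phi> \<in> {\<phi> \<in> extensional ({0..} \<times> topspace X). semiflow X \<phi>}"
    then interpret semiflow_on_finite_t0_space X \<phi>
      by unfold_locales simp
    define S where "S = {x \<in> topspace X. \<phi> (1, x) \<noteq> x}"
    have S_P: "S \<subseteq> P"
      using potential_down_beat_point_if_flow_moves by (auto simp: S_def P_def)
    \<comment> \<open>The value lies in \<open>min_open X x = {x, m x}\<close> and differs from
      \<open>x\<close>. @DONE_PLACEHOLDER\<close>
    have moved: "\<phi> (1, x) = m x" if "x \<in> S" for x
      using that flow_le[of x 1] m[of x] S_P by (auto simp: S_def)
    have "\<phi> = jump_flow m S"
    proof (rule extensionalityI)
      show "\<phi> \<in> extensional ({0..} \<times> topspace X)"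
        using \<phi> by simp
      show "jump_flow m S \<in> extensional ({0..} \<times> topspace X)"
        by (simp add: jump_flow_def)
      fix z :: "real \<times> 'a"
      assume "z \<in> {0..} \<times> topspace X"
      then obtain t x where z: "z = (t, x)" "t \<ge> 0" "x \<in> topspace X"
        by auto
      show "\<phi> z = jump_flow m S z"
      proof (cases "t = 0")
        case True
        then show ?thesis
          using z flow_0 by (simp add: jump_flow_def)
      next
        case False
        then have "\<phi> z = \<phi> (1, x)"
          using z flow_const[of x t 1] by simp
        moreover have "\<phi> (1, x) = (if x \<in> S then m x else x)"
          using moved[of x] z(3) by (cases "x \<in> S") (simp, simp add: S_def)
        ultimately show ?thesis
          using z False by (simp add: jump_flow_def)
      qed
    qed
    then show "\<exists>S \<in> Pow P. \<phi> = jump_flow m S"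
      using S_P by blast
  qed
  then have "num_semiflows X = card (Pow P)"
    unfolding num_semiflows_def by (simp add: bij_betw_same_card)
  also have "\<dots> = 2 ^ n"
    using assms(4) finite_subset[OF P_top finite_topspace] by (simp add: card_Pow P_def)
  finally show ?thesis .
qed

end
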